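(* Let $d\in\mathbb{N}$ and let $L$ be a simplicial complex with the following property: for every continuous $g:\|L\|\to\mathbb{R}^d$ there exist two disjoint non-empty faces $F,G\in L$ with $g(\|F\|)\cap g(\|G\|)\neq\emptyset$. Let $K$ be a simplicial complex with dual complex $K'$, and suppose that there exists a continuous $\phi:\|L\|\to\|K'\|$ such that $(\phi(x),\phi(y))\in\widehat{K}$ for every $(x,y)\in\|L^2_\Delta\|$ (so that $\phi$, applied on each coordinate, gives a map $\|L^2_\Delta\|\to\widehat K$). Then $K$ is not $d$-representable, and in fact $K$ is not even the nerve of a good cover in $\mathbb{R}^d$.
   Context: Simplicial complexes are finite: a simplicial complex $K\subseteq 2^V$ on a finite vertex set $V=V(K)$ is a family of subsets (faces) of $V$ closed under taking subsets, containing $\emptyset$ and with $\{i\}\in K$ for every $i\in V$. Inclusion-maximal faces are called facets, and $\mathsf m_K$ denotes the set of facets of $K$. $\mathbb N=\{1,2,\dots\}$. $K$ is the nerve of a collection of sets $\{C_i\}_{i\in V}$ in $\mathbb{R}^d$ if $K=\{I\subseteq V:\bigcap_{i\in I}C_i\neq\emptyset\}$ (the empty intersection being $\mathbb{R}^d$). $K$ is $d$-representable if it is the nerve of a collection of convex sets in $\mathbb{R}^d$. A finite collection $\{U_i\}_{i\in V}$ of subsets of $\mathbb{R}^d$ is a good cover if for every non-empty $I\subseteq V$ the intersection $\bigcap_{i\in I}U_i$ is either empty or homeomorphic to an open $d$-dimensional ball (the union need not be all of $\mathbb{R}^d$). Dual complex: $K'=\{\alpha\subseteq \mathsf m_K:\bigcap\alpha\neq\emptyset\}$,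 where $\bigcap\alpha=\bigcap_{J\in\alpha}J\subseteq V$; it is a simplicial complex with vertex set $\mathsf m_K$. Geometric realization: for a simplicial complex $L$ with vertex set $W$ and $\{e_w\}_{w\in W}$ the standard basis of $\mathbb{R}^W$, $\|F\|=\mathrm{conv}\{e_w:w\in F\}$ for $F\in L$, and $\|L\|=\bigcup_{F\in L}\|F\|$. For $x\in\|L\|$, $\mathrm{supp}(x)$ is the minimal face $F\in L$ with $x\in\|F\|$. Deleted product: $\|L^2_\Delta\|=\{(x,y)\in\|L\|^2:\mathrm{supp}(x)\cap\mathrm{supp}(y)=\emptyset\}$. Configuration space: $\widehat K=\{(x,y)\in\|K'\|^2:\ (\bigcap\mathrm{supp}(x))\cup(\bigcap\mathrm{supp}(y))\notin K\}$, where $\mathrm{supp}(x)\in K'$ is a set of facets of $K$ and $\bigcap\mathrm{supp}(x)\subseteq V$ is their intersection. *)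

theory Defs
  imports "HOL-Analysis.Analysis"
begin

text \<open>
  Finite abstract simplicial complexes. (The library constant \<open>simplicial_complex\<close> is about
  geometric complexes of polytopes.)
\<close>

definition abstract_complex :: "'v set \<Rightarrow> 'v set set \<Rightarrow> bool" where
  "abstract_complex V K \<longleftrightarrow>
     finite V \<and> K \<subseteq> Pow V \<and> {} \<in> K \<and> (\<forall>F\<in>K. \<forall>G. G \<subseteq> F \<longrightarrow> G \<in> K) \<and> (\<forall>i\<in>V. {i} \<in> K)"

definition facets :: "'v set set \<Rightarrow> 'v set set" where
  "facets K = {F \<in> K. \<forall>G\<in>K. F \<subseteq> G \<longrightarrow> G = F}"

text \<open>
  For \<open>\<alpha> = {}\<close> the intersection is \<open>UNIV\<close>, so the empty face always belongs to the dual complex.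
\<close>

definition dual_complex :: "'v set set \<Rightarrow> 'v set set set" where
  "dual_complex K = {\<alpha>. \<alpha> \<subseteq> facets K \<and> \<Inter>\<alpha> \<noteq> {}}"

text \<open>
  The vertex set of a complex is a subset of a finite type \<open>'w\<close>, and the realization
  lives in \<open>real ^ 'w\<close>; coordinates of elements that are not vertices vanish on it.
\<close>

definition face_realization :: "'w::finite set \<Rightarrow> (real ^ 'w) set" where
  "face_realization F = convex hull ((\<lambda>w. axis w 1) ` F)"

definition realization :: "'w::finite set set \<Rightarrow> (real ^ 'w) set" where
  "realization L = (\<Union>F\<in>L. face_realization F)"

definition supp :: "'w::finite set set \<Rightarrow> real ^ 'w \<Rightarrow> 'w set" where
  "supp L x = (THE F. F \<in> L \<and> x \<in> face_realization F \<and>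
     (\<forall>G\<in>L. x \<in> face_realization G \<longrightarrow> G \<subseteq> F \<longrightarrow> G = F))"

definition deleted_product :: "'w::finite set set \<Rightarrow> ((real ^ 'w) \<times> (real ^ 'w)) set" where
  "deleted_product L =
     {(x, y). x \<in> realization L \<and> y \<in> realization L \<and> supp L x \<inter> supp L y = {}}"

definition configuration_space ::
  "'v::finite set set \<Rightarrow> ((real ^ ('v set)) \<times> (real ^ ('v set))) set" where
  "configuration_space K =
     {(x, y). x \<in> realization (dual_complex K) \<and> y \<in> realization (dual_complex K) \<and>
        \<Inter>(supp (dual_complex K) x) \<union> \<Inter>(supp (dual_complex K) y) \<notin> K}"

definition nerve :: "'v set \<Rightarrow> ('v \<Rightarrow> 'a set) \<Rightarrow> 'v set set" where
  "nerve V C = {I. I \<subseteq> V \<and> (\<Inter>i\<in>I. C i) \<noteq> {}}"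

definition good_cover :: "'v set \<Rightarrow> ('v \<Rightarrow> (real ^ 'd::finite) set) \<Rightarrow> bool" where
  "good_cover V U \<longleftrightarrow> finite V \<and>
     (\<forall>I. I \<subseteq> V \<longrightarrow> I \<noteq> {} \<longrightarrow>
        (\<Inter>i\<in>I. U i) = {} \<or> (\<Inter>i\<in>I. U i) homeomorphic (ball 0 1 :: (real ^ 'd) set))"

text \<open>In the next two definitions the dimension \<open>d\<close> is the cardinality of the type \<open>'d\<close>.\<close>

definition representable_in :: "'d::finite itself \<Rightarrow> 'v set \<Rightarrow> 'v set set \<Rightarrow> bool" where
  "representable_in (_ :: 'd itself) V K \<longleftrightarrow>
     (\<exists>C :: 'v \<Rightarrow> (real ^ 'd) set. (\<forall>i\<in>V. convex (C i)) \<and> K = nerve V C)"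

definition nerve_of_good_cover_in :: "'d::finite itself \<Rightarrow> 'v set \<Rightarrow> 'v set set \<Rightarrow> bool" where
  "nerve_of_good_cover_in (_ :: 'd itself) V K \<longleftrightarrow>
     (\<exists>U :: 'v \<Rightarrow> (real ^ 'd) set. good_cover V U \<and> K = nerve V U)"

end

theory Submission
  imports Defs
begin

text \<open>
  If \<open>K\<close> is the nerve of sets all of whose non-empty intersections are absolute retracts, then
  extending over the faces of \<open>\<parallel>K'\<parallel>\<close> one at a time gives a continuous \<open>f : \<parallel>K'\<parallel> \<rightarrow> \<real>\<^sup>d\<close> that sends
  every face \<open>\<alpha>\<close> into \<open>\<Inter>\<^bsub>i \<in> \<Inter>\<alpha>\<^esub> U\<^sub>i\<close>. Whenever \<open>f\<close> identifies two points \<open>x, y\<close>, the common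
  image witnesses that \<open>(\<Inter>supp x) \<union> (\<Inter>supp y)\<close> is a face of \<open>K\<close>. Hence \<open>f \<circ> \<phi>\<close> maps disjoint faces
  of \<open>L\<close> to disjoint sets, contrary to the assumption on \<open>L\<close>.
\<close>

text \<open>Barycentric coordinates: the right-hand side is convex and contains the vertices of
  \<open>F\<close>, and each of its points is the convex combination of these vertices weighted by
  its own coordinates. Intersections of faces and supports can then be read off
  coordinatewise.\<close>

lemma face_realization_eq:
  fixes F :: "'w::finite set"
  shows "face_realization F = {x. (\<forall>w. 0 \<le> x $ w) \<and> (\<Sum>w\<in>UNIV. x $ w) = 1 \<and> (\<forall>w. w \<notin> F \<longrightarrow> x $ w = 0)}"
    (is "_ = ?R")
proof
  have "convex ?R"
    by (rule convexI) (auto simp: sum.distrib sum_distrib_left[symmetric])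
  moreover have "(\<lambda>w. axis w 1) ` F \<subseteq> ?R"
    by (auto simp: axis_def)
  ultimately show "face_realization F \<subseteq> ?R"
    unfolding face_realization_def by (rule hull_minimal[rotated])
next
  show "?R \<subseteq> face_realization F"
  proof
    fix x assume x: "x \<in> ?R"
    have "(\<Sum>w\<in>F. x $ w) = (\<Sum>w\<in>UNIV. x $ w)"
      using x by (intro sum.mono_neutral_left) auto
    then have "(\<Sum>w\<in>F. x $ w *\<^sub>R (axis w 1 :: real ^ 'w)) \<in> face_realization F"
      unfolding face_realization_def using x
      by (intro convex_sum) (auto intro: hull_inc)
    moreover have "(\<Sum>w\<in>F. x $ w *\<^sub>R (axis w 1 :: real ^ 'w)) = (\<Sum>w\<in>UNIV. x $ w *\<^sub>R axis w 1)"
      using x by (intro sum.mono_neutral_left) auto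
    ultimately show "x \<in> face_realization F"
      using basis_expansion[of x] by (simp add: scalar_mult_eq_scaleR)
  qed
qed

lemma face_realization_Int:
  "face_realization F \<inter> face_realization G = face_realization (F \<inter> G)"
  unfolding face_realization_eq by blast

lemma face_realization_empty [simp]: "face_realization {} = {}"
  by (simp add: face_realization_def)

lemma compact_face_realization: "compact (face_realization F)"
  unfolding face_realization_def by (intro compact_convex_hull finite_imp_compact) simp

lemma closed_realization: "closed (realization L)"
  unfolding realization_def
  by (intro closed_UN) (auto intro: compact_imp_closed compact_face_realization)

text \<open>The set of non-zero coordinates lies in every \<open>G\<close> whose realization
  contains \<open>x\<close>, and downward closure puts it into \<open>L\<close>. It is therefore the
  least such face, so the definite description in \<open>supp\<close> has a unique solution.\<close>

lemma supp_eq: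
  assumes down: "\<And>F G. F \<in> L \<Longrightarrow> G \<subseteq> F \<Longrightarrow> G \<in> L" and x: "x \<in> realization L"
  shows "supp L x = {w. x $ w \<noteq> 0}"
proof -
  let ?S = "{w. x $ w \<noteq> 0}"
  obtain F where F: "F \<in> L" "x \<in> face_realization F"
    using x by (auto simp: realization_def)
  have le: "?S \<subseteq> G" if "x \<in> face_realization G" for G
    using that by (auto simp: face_realization_eq)
  have mem: "?S \<in> L" using down F le by blast
  have face: "x \<in> face_realization ?S"
    using F by (auto simp: face_realization_eq)
  show ?thesis
    unfolding supp_def
  proof (rule the_equality)
    show "?S \<in> L \<and> x \<in> face_realization ?S \<and>
        (\<forall>G\<in>L. x \<in> face_realization G \<longrightarrow> G \<subseteq> ?S \<longrightarrow> G = ?S)"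
      using mem face le by blast
    show "G = ?S" if "G \<in> L \<and> x \<in> face_realization G \<and>
        (\<forall>H\<in>L. x \<in> face_realization H \<longrightarrow> H \<subseteq> G \<longrightarrow> H = G)" for G
      using that mem face le by blast
  qed
qed

lemma
  assumes "\<And>F G. F \<in> L \<Longrightarrow> G \<subseteq> F \<Longrightarrow> G \<in> L" and "x \<in> realization L"
  shows supp_in_complex: "supp L x \<in> L"
    and in_face_realization_supp: "x \<in> face_realization (supp L x)"
    and supp_subset: "x \<in> face_realization F \<Longrightarrow> supp L x \<subseteq> F"
proof -
  obtain F where F: "F \<in> L" "x \<in> face_realization F"
    using assms(2) by (auto simp: realization_def)
  have eq: "supp L x = {w. x $ w \<noteq> 0}"
    using assms by (rule supp_eq)
  show le: "supp L x \<subseteq> F" if "x \<in> face_realization F" for F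
    using that by (auto simp: eq face_realization_eq)
  show "supp L x \<in> L"
    using assms(1) F le by blast
  show "x \<in> face_realization (supp L x)"
    using F by (auto simp: eq face_realization_eq)
qed

text \<open>Induction over subcomplexes: take away a maximal face \<open>A\<close>, map the rest,
  then extend over \<open>A\<close>. The extension exists because \<open>T A\<close>, an absolute
  retract, admits extensions of maps from closed subsets. Nothing is asked of \<open>T {}\<close>,
  as the empty face has empty realization.\<close>

lemma extension_face_by_face:
  fixes T :: "'w::finite set \<Rightarrow> 'a::euclidean_space set"
  assumes "\<And>F G. F \<in> L \<Longrightarrow> G \<subseteq> F \<Longrightarrow> G \<in> L"
    and "\<And>F. F \<in> L \<Longrightarrow> F \<noteq> {} \<Longrightarrow> AR (T F)"
    and "\<And>F G. F \<in> L \<Longrightarrow> G \<subseteq> F \<Longrightarrow> G \<noteq> {} \<Longrightarrow> T G \<subseteq> T F"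
  shows "\<exists>f. continuous_on (realization L) f \<and> (\<forall>F\<in>L. f ` face_realization F \<subseteq> T F)"
proof -
  have "finite L" by simp
  then show ?thesis
    using assms
  proof (induction L rule: finite_psubset_induct)
    case (psubset L)
    show ?case
    proof (cases "L \<subseteq> {{}}")
      case True
      then have "realization L = {}" "\<forall>F\<in>L. face_realization F = {}"
        by (auto simp: realization_def)
      then show ?thesis by auto
    next
      case False
      then obtain A where A: "A \<in> L" and max: "\<And>B. B \<in> L \<Longrightarrow> A \<subseteq> B \<Longrightarrow> B = A"
        using finite_has_maximal[OF psubset.hyps] by blast
      have "A \<noteq> {}"
        using False max by blast
      \<comment> \<open>Maximality of \<open>A\<close> keeps \<open>L - {A}\<close> closed under
        subsets.\<close>
      let ?M = "L - {A}"
      have "\<exists>f. continuous_on (realization ?M) f \<and> (\<forall>F\<in>?M. f ` face_realization F \<subseteq> T F)"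
      proof (rule psubset.IH)
        show "?M \<subset> L" using A by blast
        show "G \<in> ?M" if "F \<in> ?M" "G \<subseteq> F" for F G
          using that max psubset.prems(1)[of F G] by blast
        show "AR (T F)" if "F \<in> ?M" "F \<noteq> {}" for F
          using that psubset.prems(2)[of F] by simp
        show "T G \<subseteq> T F" if "F \<in> ?M" "G \<subseteq> F" "G \<noteq> {}" for F G
          using that psubset.prems(3)[of F G] by simp
      qed
      then obtain f where f: "continuous_on (realization ?M) f"
        and fT: "\<And>F. F \<in> ?M \<Longrightarrow> f ` face_realization F \<subseteq> T F"
        by blast
      let ?B = "face_realization A \<inter> realization ?M"
      \<comment> \<open>By maximality, any other face \<open>G\<close> meets \<open>A\<close> in a
        proper face of \<open>A\<close>. There \<open>f\<close> takes values in
        \<open>T (A \<inter> G)\<close>, which monotonicity places inside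
        \<open>T A\<close>.\<close>
      have "f ` ?B \<subseteq> T A"
      proof (rule image_subsetI)
        fix x assume x: "x \<in> ?B"
        then obtain G where G: "G \<in> ?M" "x \<in> face_realization G"
          by (auto simp: realization_def)
        then have xAG: "x \<in> face_realization (A \<inter> G)"
          using x face_realization_Int[of A G] by blast
        have "A \<inter> G \<in> ?M"
          using A G max psubset.prems(1)[of A "A \<inter> G"] by blast
        then have "f x \<in> T (A \<inter> G)"
          using fT xAG by blast
        moreover have "A \<inter> G \<noteq> {}"
          using xAG by auto
        ultimately show "f x \<in> T A"
          using psubset.prems(3)[OF A, of "A \<inter> G"] by blast
      qed
      moreover have "continuous_on ?B f"
        using f by (rule continuous_on_subset) simp
      moreover have "closedin (top_of_set (face_realization A)) ?B"
        by (rule closedin_closed_Int) (rule closed_realization)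
      moreover have "AR (T A)"
        using psubset.prems(2) A \<open>A \<noteq> {}\<close> .
      ultimately obtain h where h: "continuous_on (face_realization A) h"
        and hT: "h ` face_realization A \<subseteq> T A" and hf: "\<And>x. x \<in> ?B \<Longrightarrow> h x = f x"
        using AR_imp_absolute_extensor by metis
      \<comment> \<open>Both pieces are closed and \<open>h\<close> agrees with \<open>f\<close> on
        their overlap, so the glued map is continuous.\<close>
      let ?g = "\<lambda>x. if x \<in> face_realization A then h x else f x"
      have "continuous_on (face_realization A \<union> realization ?M) ?g"
        using h f hf
        by (intro continuous_on_cases) (auto simp: closed_realization compact_face_realization compact_imp_closed)
      moreover have "realization L = face_realization A \<union> realization ?M"
        using A by (auto simp: realization_def)
      moreover have "?g ` face_realization F \<subseteq> T F" if "F \<in> L" for F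
      proof (cases "F = A")
        case True
        then show ?thesis using hT by auto
      next
        case False
        then have "F \<in> ?M" using that by blast
        \<comment> \<open>A face other than \<open>A\<close> may still meet \<open>A\<close>, but
          only inside \<open>?B\<close>, where \<open>h\<close> coincides with
          \<open>f\<close>.\<close>
        moreover have "?g x = f x" if "x \<in> face_realization F" for x
          using that hf \<open>F \<in> ?M\<close> by (auto simp: realization_def)
        ultimately show ?thesis using fT by auto
      qed
      ultimately show ?thesis
        by (intro exI[of _ ?g] conjI ballI) (simp_all only:)
    qed
  qed
qed

text \<open>Serves both claims of the theorem, since non-empty convex sets and homeomorphs of open
  balls are alike absolute retracts.\<close>

lemma not_nerve_of_AR_cover:
  fixes L :: "'w::finite set set" and K :: "'v::finite set set"
    and \<phi> :: "real ^ 'w \<Rightarrow> real ^ ('v set)" and U :: "'v \<Rightarrow> 'a::euclidean_space set"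
  assumes L: "abstract_complex W L"
    and K: "abstract_complex V K"
    and nonembed: "\<And>g :: real ^ 'w \<Rightarrow> 'a. continuous_on (realization L) g \<Longrightarrow>
           \<exists>F\<in>L. \<exists>G\<in>L. F \<noteq> {} \<and> G \<noteq> {} \<and> F \<inter> G = {} \<and>
             g ` face_realization F \<inter> g ` face_realization G \<noteq> {}"
    and \<phi>: "continuous_on (realization L) \<phi>" "\<phi> ` realization L \<subseteq> realization (dual_complex K)"
    and conf: "\<And>x y. (x, y) \<in> deleted_product L \<Longrightarrow> (\<phi> x, \<phi> y) \<in> configuration_space K"
    and AR: "\<And>I. I \<in> K \<Longrightarrow> I \<noteq> {} \<Longrightarrow> AR (\<Inter>i\<in>I. U i)"
  shows "K \<noteq> nerve V U"
proof
  assume nerve: "K = nerve V U"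
  let ?D = "dual_complex K"
  have downL: "G \<in> L" if "F \<in> L" "G \<subseteq> F" for F G
    using L that by (auto simp: abstract_complex_def)
  have downD: "\<beta> \<in> ?D" if "\<alpha> \<in> ?D" "\<beta> \<subseteq> \<alpha>" for \<alpha> \<beta>
    using that Inter_anti_mono[of \<beta> \<alpha>] unfolding dual_complex_def by blast
  \<comment> \<open>Any member \<open>J\<close> of \<open>\<alpha>\<close> is a face of
    \<open>K\<close> containing \<open>\<Inter>\<alpha>\<close>; for empty \<open>\<alpha>\<close>
    the intersection would be \<open>UNIV\<close>.\<close>
  have Inter_in_K: "\<Inter>\<alpha> \<in> K" if \<alpha>: "\<alpha> \<in> ?D" "\<alpha> \<noteq> {}" for \<alpha>
  proof -
    obtain J where "J \<in> \<alpha>" using \<alpha> by blast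
    then have "J \<in> K" "\<Inter>\<alpha> \<subseteq> J" using \<alpha> by (auto simp: dual_complex_def facets_def)
    then show ?thesis using K by (auto simp: abstract_complex_def)
  qed
  have "\<exists>f. continuous_on (realization ?D) f \<and>
      (\<forall>\<alpha>\<in>?D. f ` face_realization \<alpha> \<subseteq> (\<Inter>i\<in>\<Inter>\<alpha>. U i))"
  proof (rule extension_face_by_face)
    show "AR (\<Inter>i\<in>\<Inter>\<alpha>. U i)" if "\<alpha> \<in> ?D" "\<alpha> \<noteq> {}" for \<alpha>
      using that by (intro AR Inter_in_K) (auto simp: dual_complex_def)
    \<comment> \<open>The order is reversed twice: fewer facets have a larger intersection, and more
      indices cut out a smaller set.\<close>
    show "(\<Inter>i\<in>\<Inter>\<beta>. U i) \<subseteq> (\<Inter>i\<in>\<Inter>\<alpha>. U i)" if "\<beta> \<subseteq> \<alpha>" for \<alpha> \<beta>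
      using that by blast
  qed (fact downD)
  then obtain f where f: "continuous_on (realization ?D) f"
    and fU: "\<And>\<alpha>. \<alpha> \<in> ?D \<Longrightarrow> f ` face_realization \<alpha> \<subseteq> (\<Inter>i\<in>\<Inter>\<alpha>. U i)"
    by blast
  have "continuous_on (realization L) (f \<circ> \<phi>)"
    using \<phi> f by (intro continuous_on_compose) (auto intro: continuous_on_subset)
  then obtain F G x y where FG: "F \<in> L" "G \<in> L" "F \<inter> G = {}"
    and xy: "x \<in> face_realization F" "y \<in> face_realization G" and eq: "f (\<phi> x) = f (\<phi> y)"
    using nonembed[of "f \<circ> \<phi>"] by auto
  have xyL: "x \<in> realization L" "y \<in> realization L"
    using FG xy by (auto simp: realization_def)
  have "supp L x \<subseteq> F" "supp L y \<subseteq> G"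
    using supp_subset[OF downL xyL(1) xy(1)] supp_subset[OF downL xyL(2) xy(2)] by auto
  \<comment> \<open>The supports inherit disjointness from \<open>F\<close> and \<open>G\<close>,
    which makes \<open>conf\<close> applicable to this pair.\<close>
  then have "(x, y) \<in> deleted_product L"
    using FG xyL by (auto simp: deleted_product_def)
  then have notin: "\<Inter>(supp ?D (\<phi> x)) \<union> \<Inter>(supp ?D (\<phi> y)) \<notin> K"
    using conf by (auto simp: configuration_space_def)
  have supp_D: "\<Inter>(supp ?D (\<phi> z)) \<in> K \<and> f (\<phi> z) \<in> (\<Inter>i\<in>\<Inter>(supp ?D (\<phi> z)). U i)"
    if "z \<in> realization L" for z
  proof -
    have z: "\<phi> z \<in> realization ?D"
      using that \<phi> by blast
    have mem: "supp ?D (\<phi> z) \<in> ?D" and face: "\<phi> z \<in> face_realization (supp ?D (\<phi> z))"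
      using supp_in_complex[OF downD z] in_face_realization_supp[OF downD z] by auto
    \<comment> \<open>The realization of the support contains \<open>\<phi> z\<close>, whereas that
      of the empty face is empty.\<close>
    have "supp ?D (\<phi> z) \<noteq> {}"
      using face by force
    then show ?thesis
      using Inter_in_K[OF mem] fU[OF mem] face by blast
  qed
  have "f (\<phi> x) \<in> (\<Inter>i\<in>\<Inter>(supp ?D (\<phi> x)) \<union> \<Inter>(supp ?D (\<phi> y)). U i)"
    using supp_D[OF xyL(1)] supp_D[OF xyL(2)] eq by auto
  \<comment> \<open>Membership in the nerve requires indices from \<open>V\<close> besides a common
    point; here both index sets are faces of \<open>K\<close>.\<close>
  moreover have "\<Inter>(supp ?D (\<phi> x)) \<union> \<Inter>(supp ?D (\<phi> y)) \<subseteq> V"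
    using supp_D[OF xyL(1)] supp_D[OF xyL(2)] K by (auto simp: abstract_complex_def)
  ultimately have "\<Inter>(supp ?D (\<phi> x)) \<union> \<Inter>(supp ?D (\<phi> y)) \<in> K"
    unfolding nerve nerve_def by blast
  with notin show False ..
qed

theorem theorem3p15:
  fixes W :: "'w::finite set" and L :: "'w set set"
    and V :: "'v::finite set" and K :: "'v set set"
    and \<phi> :: "real ^ 'w \<Rightarrow> real ^ ('v set)"
  assumes "abstract_complex W L"
    and "\<And>g :: real ^ 'w \<Rightarrow> real ^ 'd::finite. continuous_on (realization L) g \<Longrightarrow>
           \<exists>F\<in>L. \<exists>G\<in>L. F \<noteq> {} \<and> G \<noteq> {} \<and> F \<inter> G = {} \<and>
             g ` face_realization F \<inter> g ` face_realization G \<noteq> {}"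
    and "abstract_complex V K"
    and "continuous_on (realization L) \<phi>"
    and "\<phi> ` realization L \<subseteq> realization (dual_complex K)"
    and "\<And>x y. (x, y) \<in> deleted_product L \<Longrightarrow> (\<phi> x, \<phi> y) \<in> configuration_space K"
  shows "\<not> representable_in TYPE('d) V K \<and> \<not> nerve_of_good_cover_in TYPE('d) V K"
proof -
  have not_nerve: "K \<noteq> nerve V U"
    if "\<And>I. I \<in> K \<Longrightarrow> I \<noteq> {} \<Longrightarrow> AR (\<Inter>i\<in>I. U i)" for U :: "'v \<Rightarrow> (real ^ 'd) set"
    by (rule not_nerve_of_AR_cover[OF assms(1,3,2,4-6) that])
  show ?thesis
  proof
    show "\<not> representable_in TYPE('d) V K"
    proof
      assume "representable_in TYPE('d) V K"
      then obtain C :: "'v \<Rightarrow> (real ^ 'd) set"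
        where C: "\<forall>i\<in>V. convex (C i)" and nerve: "K = nerve V C"
        by (auto simp: representable_in_def)
      \<comment> \<open>The nerve condition supplies the non-emptiness that
        \<open>convex_imp_AR\<close> demands.\<close>
      have "AR (\<Inter>i\<in>I. C i)" if "I \<in> K" for I
        using that C nerve by (intro convex_imp_AR convex_INT) (auto simp: nerve_def)
      then show False using not_nerve nerve by blast
    qed
    show "\<not> nerve_of_good_cover_in TYPE('d) V K"
    proof
      assume "nerve_of_good_cover_in TYPE('d) V K"
      then obtain U :: "'v \<Rightarrow> (real ^ 'd) set"
        where U: "good_cover V U" and nerve: "K = nerve V U"
        by (auto simp: nerve_of_good_cover_in_def)
      have "AR (\<Inter>i\<in>I. U i)" if "I \<in> K" "I \<noteq> {}" for I
      proof -
        \<comment> \<open>A face of the nerve excludes the empty alternative in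
          \<open>good_cover\<close>; being an absolute retract then transfers from the ball by
          homeomorphism.\<close>
        have "(\<Inter>i\<in>I. U i) homeomorphic (ball 0 1 :: (real ^ 'd) set)"
          using that U nerve by (auto simp: nerve_def good_cover_def)
        moreover have "AR (ball 0 1 :: (real ^ 'd) set)"
          by (intro convex_imp_AR) auto
        ultimately show ?thesis
          using homeomorphic_AR_iff_AR by blast
      qed
      then show False using not_nerve nerve by blast
    qed
  qed
qed

end
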